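(* Let $k\ge1$ and let $R$ be a unital commutative ring containing units $A_0,q_0,q,\lambda$ and elements $q_1,\dots,q_{k-1},A_1,\dots,A_{k-1}$ with $\lambda-\lambda^{-1}=\delta(1-A_0)$, $\delta=q-q^{-1}$, and suppose the family $(A_0,\dots,A_{k-1},q_0,\dots,q_{k-1},q,\lambda)$ is admissible. Then there exists a unique ring homomorphism $R_0\to R$ which respects the parameters (i.e. sends each of the parameters $q,\lambda,q_i,A_i$ of $R_0$ to the parameter of the same name in $R$).
   Context: Put $q_k:=-1$, $\delta:=q-q^{-1}$, $z:=\lceil k/2\rceil$, and $\epsilon:=2z-k\in\{0,1\}$. In any unital commutative ring containing units $A_0,q_0,q,\lambda$ and elements $q_1,\dots,q_{k-1},A_1,\dots,A_{k-1}$ define $$\beta:=q_0\lambda-q_0^{-1}\lambda^{-1}+(1-\epsilon)\delta,\qquad h_0:=\lambda-\lambda^{-1}+\delta(A_0-1),$$ for $1\le l\le k-1$, $$h_l:=\lambda^{-1}(q_l+q_0^{-1}q_{k-l})+\delta\Big[\sum_{r=1}^{k-l}q_{r+l}A_r-\sum_{i=\max(l+1,z)}^{\lfloor (l+k)/2\rfloor}q_{2i-l}+\sum_{i=\lceil l/2\rceil}^{\min(l,z-1)}q_{2i-l}\Big],$$ and for $1\le l\le z-\epsilon$, $$h_l':=\sum_{r=1}^{l}q_0^{-1}q_{r+k-l}A_r-\sum_{r=0}^{k-l}q_{r+l}A_r-\sum_{i=\lceil l/2\rceil}^{l-1}(q_0^{-1}q_{k-2i+l}+q_{2i-l})+\sum_{i=z}^{\lfloor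 (l+k)/2\rfloor}(q_0^{-1}q_{k-2i+l}+q_{2i-l}).$$ The parameters of $R$ are called admissible if $\beta=h_0=h_1=\dots=h_{z-\epsilon}=h_1'=\dots=h_{z-\epsilon}'=0$ in $R$. Let $\Omega:=\mathbb Z[q^{\pm1},\lambda^{\pm1},q_0^{\pm1},q_1,\dots,q_{k-1},A_0^{\pm1},A_1,\dots,A_{k-1}]$ (Laurent polynomial/polynomial ring in these indeterminates), let $I_0$ be the ideal of $\Omega$ generated by $\beta,h_0,h_1,\dots,h_{z-\epsilon},h_1',\dots,h_{z-\epsilon}'$, and $R_0:=\Omega/I_0$. *)

theory Defs
  imports "HOL-Algebra.QuotRing" "HOL-Library.Poly_Mapping"
begin

context
  fixes R :: "('a, 'm) ring_scheme" (structure)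
    and k :: nat          \<comment> \<open>the parameter \<open>k \<ge> 1\<close>\<close>
    and A :: "nat \<Rightarrow> 'a"   \<comment> \<open>\<open>A\<^sub>0, \<dots>, A\<^sub>k\<^sub>-\<^sub>1\<close>; other values are never used\<close>
    and qs :: "nat \<Rightarrow> 'a"  \<comment> \<open>\<open>q\<^sub>0, \<dots>, q\<^sub>k\<^sub>-\<^sub>1\<close>; other values are never used\<close>
    and q :: 'a
    and lam :: 'a
begin

definition qx :: "nat \<Rightarrow> 'a" where  \<comment> \<open>the family \<open>q\<^sub>i\<close> extended by the convention \<open>q\<^sub>k = -1\<close>\<close>
  "qx i = (if i = k then \<ominus> \<one> else qs i)"

definition delta :: 'a where
  "delta = q \<ominus> inv q"

definition zz :: nat where  \<comment> \<open>\<open>\<lceil>k/2\<rceil>\<close>\<close>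
  "zz = (k + 1) div 2"

definition eps :: nat where  \<comment> \<open>never truncated, since \<open>2 * zz \<ge> k\<close>\<close>
  "eps = 2 * zz - k"

definition beta :: 'a where
  "beta = qs 0 \<otimes> lam \<ominus> inv (qs 0) \<otimes> inv lam \<oplus> [(1 - eps)] \<cdot> delta"

definition h0 :: 'a where
  "h0 = lam \<ominus> inv lam \<oplus> delta \<otimes> (A 0 \<ominus> \<one>)"

text \<open>
  In the next two definitions \<open>l\<close> is meant to lie in \<open>{1..k - 1}\<close> and \<open>{1..zz - eps}\<close>,
  respectively; then no subtraction of natural numbers is truncated and all indices of
  \<open>qx\<close> are at most \<open>k\<close>. Note \<open>\<lceil>l/2\<rceil> = (l + 1) div 2\<close> and \<open>\<lfloor>(l + k)/2\<rfloor> = (l + k) div 2\<close>.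
\<close>

definition h :: "nat \<Rightarrow> 'a" where
  "h l = inv lam \<otimes> (qx l \<oplus> inv (qx 0) \<otimes> qx (k - l))
     \<oplus> delta \<otimes>
       ((\<Oplus>r\<in>{1..k - l}. qx (r + l) \<otimes> A r)
        \<ominus> (\<Oplus>i\<in>{max (l + 1) zz..(l + k) div 2}. qx (2 * i - l))
        \<oplus> (\<Oplus>i\<in>{(l + 1) div 2..min l (zz - 1)}. qx (2 * i - l)))"

definition h' :: "nat \<Rightarrow> 'a" where
  "h' l = (\<Oplus>r\<in>{1..l}. inv (qx 0) \<otimes> qx (r + k - l) \<otimes> A r)
     \<ominus> (\<Oplus>r\<in>{0..k - l}. qx (r + l) \<otimes> A r)
     \<ominus> (\<Oplus>i\<in>{(l + 1) div 2..l - 1}. inv (qx 0) \<otimes> qx (k + l - 2 * i) \<oplus> qx (2 * i - l))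
     \<oplus> (\<Oplus>i\<in>{zz..(l + k) div 2}. inv (qx 0) \<otimes> qx (k + l - 2 * i) \<oplus> qx (2 * i - l))"

definition relators :: "'a set" where
  "relators = {beta, h0} \<union> h ` {1..zz - eps} \<union> h' ` {1..zz - eps}"

definition admissible :: bool where
  "admissible \<longleftrightarrow> (\<forall>x\<in>relators. x = \<zero>)"

end

datatype indet = Ind_q | Ind_lam | Ind_qs nat | Ind_A nat

definition indets :: "nat \<Rightarrow> indet set" where
  "indets k = {Ind_q, Ind_lam} \<union> Ind_qs ` {0..<k} \<union> Ind_A ` {0..<k}"

definition unit_indets :: "indet set" where
  "unit_indets = {Ind_q, Ind_lam, Ind_qs 0, Ind_A 0}"

text \<open>
  The type \<open>(indet \<Rightarrow>\<^sub>0 int) \<Rightarrow>\<^sub>0 int\<close>, with the convolution product of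
  \<^theory>\<open>HOL-Library.Poly_Mapping\<close>, is the ring of Laurent polynomials with integer coefficients
  in all elements of \<^typ>\<open>indet\<close>: a monomial is its exponent vector \<open>indet \<Rightarrow>\<^sub>0 int\<close>.
  The ring \<open>\<Omega>\<close> is the subring spanned by the monomials in \<open>indets k\<close> in which only
  the members of \<open>unit_indets\<close> have negative exponents.
\<close>

definition Omega_monoms :: "nat \<Rightarrow> (indet \<Rightarrow>\<^sub>0 int) set" where
  "Omega_monoms k = {m. Poly_Mapping.keys m \<subseteq> indets k \<and>
     (\<forall>v. v \<notin> unit_indets \<longrightarrow> 0 \<le> Poly_Mapping.lookup m v)}"

definition Omega :: "nat \<Rightarrow> ((indet \<Rightarrow>\<^sub>0 int) \<Rightarrow>\<^sub>0 int) ring" where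
  "Omega k = \<lparr>carrier = {p. Poly_Mapping.keys p \<subseteq> Omega_monoms k},
     mult = (*), one = 1, zero = 0, add = (+)\<rparr>"

definition indet_poly :: "indet \<Rightarrow> (indet \<Rightarrow>\<^sub>0 int) \<Rightarrow>\<^sub>0 int" where
  "indet_poly v = Poly_Mapping.single (Poly_Mapping.single v 1) 1"

definition I0 :: "nat \<Rightarrow> ((indet \<Rightarrow>\<^sub>0 int) \<Rightarrow>\<^sub>0 int) set" where
  "I0 k = Idl\<^bsub>Omega k\<^esub> (relators (Omega k) k
     (\<lambda>i. indet_poly (Ind_A i)) (\<lambda>i. indet_poly (Ind_qs i))
     (indet_poly Ind_q) (indet_poly Ind_lam))"

definition R0 :: "nat \<Rightarrow> ((indet \<Rightarrow>\<^sub>0 int) \<Rightarrow>\<^sub>0 int) set ring" where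
  "R0 k = Omega k Quot I0 k"

definition R0_param :: "nat \<Rightarrow> indet \<Rightarrow> ((indet \<Rightarrow>\<^sub>0 int) \<Rightarrow>\<^sub>0 int) set" where
  "R0_param k v = I0 k +>\<^bsub>Omega k\<^esub> indet_poly v"

end

theory Submission
  imports Defs "HOL-Algebra.Free_Abelian_Groups" "HOL-Algebra.Multiplicative_Group"
begin

text \<open>
  As an additive group, \<open>\<Omega>\<close> is free abelian on its monoid of monomials, so a multiplicative map
  from the monomials to \<open>R\<close> extends uniquely to a ring homomorphism; a multiplicative map on the
  monomials is given by the values of the indeterminates, those in \<^const>\<open>unit_indets\<close> being units.
  The resulting \<open>\<Omega> \<rightarrow> R\<close> carries the relators of \<open>\<Omega>\<close> to those of \<open>R\<close>, which vanish by
  admissibility, and hence factors through \<open>R\<^sub>0\<close>.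
\<close>

section \<open>Homomorphisms of commutative rings: units, finite sums, quotients\<close>

lemma (in ring_hom_cring) hom_minus:
  "\<lbrakk>x \<in> carrier R; y \<in> carrier R\<rbrakk> \<Longrightarrow> h (x \<ominus> y) = h x \<ominus>\<^bsub>S\<^esub> h y"
  by (simp add: a_minus_def)

lemma (in ring_hom_cring) hom_add_pow:
  "x \<in> carrier R \<Longrightarrow> h ([(n::nat)] \<cdot> x) = [n] \<cdot>\<^bsub>S\<^esub> h x"
  by (induction n) simp_all

lemma (in ring_hom_cring) hom_Units:
  assumes "x \<in> Units R"
  shows "h x \<in> Units S" and "h (inv x) = inv\<^bsub>S\<^esub> h x"
proof -
  have x: "x \<in> carrier R" and i: "inv x \<in> carrier R"
    using assms by auto
  have e: "h x \<otimes>\<^bsub>S\<^esub> h (inv x) = \<one>\<^bsub>S\<^esub>"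
    using assms x i by (simp flip: hom_mult)
  then have e': "h (inv x) \<otimes>\<^bsub>S\<^esub> h x = \<one>\<^bsub>S\<^esub>"
    using x i by (simp add: S.m_comm)
  show "h x \<in> Units S"
    using e e' x i unfolding Units_def by blast
  show "h (inv x) = inv\<^bsub>S\<^esub> h x"
    using S.comm_inv_char[of "h x" "h (inv x)"] e x i by simp
qed

text \<open>The hypotheses are restricted to the index set, so that bounds on the summation index
  remain available when the sums in the relators are pushed through a homomorphism.\<close>

lemma (in ring_hom_cring) hom_finsum_cong:
  assumes "\<And>i. i \<in> I \<Longrightarrow> f i \<in> carrier R" and "\<And>i. i \<in> I \<Longrightarrow> h (f i) = g i"
  shows "h (\<Oplus>i\<in>I. f i) = (\<Oplus>\<^bsub>S\<^esub>i\<in>I. g i)"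
proof -
  have "h (\<Oplus>i\<in>I. f i) = (\<Oplus>\<^bsub>S\<^esub>i\<in>I. (h \<circ> f) i)"
    using assms(1) by (intro hom_finsum) auto
  also have "\<dots> = (\<Oplus>\<^bsub>S\<^esub>i\<in>I. g i)"
    using assms by (intro S.finsum_cong') (auto simp flip: assms(2))
  finally show ?thesis .
qed

text \<open>The ideal need only lie in the kernel, as will be shown for \<open>I0 k\<close>. The
  induced map sends a coset to the single element of its image.\<close>

lemma (in ring_hom_cring) quotient_hom_exists:
  assumes I: "ideal I R" and ker: "\<And>x. x \<in> I \<Longrightarrow> h x = \<zero>\<^bsub>S\<^esub>"
  obtains g where "g \<in> ring_hom (R Quot I) S" "g \<in> extensional (carrier (R Quot I))"
    "\<And>x. x \<in> carrier R \<Longrightarrow> g (I +> x) = h x"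
proof -
  interpret I: ideal I R by (rule I)
  have carr: "carrier (R Quot I) = (\<lambda>x. I +> x) ` carrier R"
    by (simp add: FactRing_def A_RCOSETS_def' UNION_singleton_eq_range)
  \<comment> \<open>Elements of one coset differ by elements of \<open>I\<close>, which
    \<open>h\<close> kills; this makes \<open>the_elem\<close> below well defined.\<close>
  have img: "h ` (I +> x) = {h x}" if x: "x \<in> carrier R" for x
  proof -
    have "h y = h x" if y: "y \<in> I +> x" for y
    proof -
      obtain i where i: "i \<in> I" "y = i \<oplus> x"
        using y by (auto simp: a_r_coset_def')
      then have "h y = h i \<oplus>\<^bsub>S\<^esub> h x"
        using x I.Icarr by simp
      then show ?thesis
        using x ker[OF i(1)] by simp
    qed
    moreover have "x \<in> I +> x"
      using x by (rule I.a_rcos_self)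
    ultimately show ?thesis by blast
  qed
  define g where "g = (\<lambda>X\<in>carrier (R Quot I). the_elem (h ` X))"
  have g: "g (I +> x) = h x" if "x \<in> carrier R" for x
    unfolding g_def carr using that by (simp add: img)
  note \<pi> = I.rcos_ring_hom
  have "g \<in> ring_hom (R Quot I) S"
  proof (rule ring_hom_memI)
    show "g X \<in> carrier S" if "X \<in> carrier (R Quot I)" for X
    proof -
      from that carr obtain x where "X = I +> x" "x \<in> carrier R" by blast
      then show ?thesis by (simp add: g)
    qed
    show "g \<one>\<^bsub>R Quot I\<^esub> = \<one>\<^bsub>S\<^esub>"
      using g[of \<one>] by (simp flip: ring_hom_one[OF \<pi>])
    fix X Y assume "X \<in> carrier (R Quot I)" "Y \<in> carrier (R Quot I)"
    then obtain x y where xy: "X = I +> x" "Y = I +> y" "x \<in> carrier R" "y \<in> carrier R"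
      using carr by auto
    show "g (X \<otimes>\<^bsub>R Quot I\<^esub> Y) = g X \<otimes>\<^bsub>S\<^esub> g Y"
      unfolding xy(1,2) ring_hom_mult[OF \<pi> xy(3,4), symmetric] using xy(3,4) by (simp add: g)
    show "g (X \<oplus>\<^bsub>R Quot I\<^esub> Y) = g X \<oplus>\<^bsub>S\<^esub> g Y"
      unfolding xy(1,2) ring_hom_add[OF \<pi> xy(3,4), symmetric] using xy(3,4) by (simp add: g)
  qed
  moreover have "g \<in> extensional (carrier (R Quot I))"
    by (simp add: g_def)
  ultimately show thesis
    using that g by blast
qed


section \<open>Monoid rings with integer coefficients\<close>

text \<open>The carrier is that of \<open>free_Abelian_group M\<close>, with
  \<open>frag_of a\<close> as the monomial of exponent \<open>a\<close>; this gives access to the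
  universal property and the induction rule of free abelian groups.\<close>

definition monoid_ring :: "'b::comm_monoid_add set \<Rightarrow> ('b \<Rightarrow>\<^sub>0 int) ring" where
  "monoid_ring M = \<lparr>carrier = {p. Poly_Mapping.keys p \<subseteq> M},
     mult = (*), one = 1, ring.zero = 0, add = (+)\<rparr>"

locale add_submonoid =
  fixes M :: "'b::comm_monoid_add set"
  assumes zero_mem: "0 \<in> M" and add_mem: "a \<in> M \<Longrightarrow> b \<in> M \<Longrightarrow> a + b \<in> M"
begin

lemma cring_monoid_ring: "cring (monoid_ring M)"
proof (rule cringI)
  show "abelian_group (monoid_ring M)"
  proof (rule abelian_groupI)
    show "\<exists>y\<in>carrier (monoid_ring M). y \<oplus>\<^bsub>monoid_ring M\<^esub> x = \<zero>\<^bsub>monoid_ring M\<^esub>"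
      if "x \<in> carrier (monoid_ring M)" for x
      using that by (intro bexI[of _ "- x"]) (auto simp: monoid_ring_def)
  qed (use keys_add in \<open>fastforce simp: monoid_ring_def algebra_simps\<close>)+
  show "Group.comm_monoid (monoid_ring M)"
  proof (rule comm_monoidI)
    fix x y assume "x \<in> carrier (monoid_ring M)" "y \<in> carrier (monoid_ring M)"
    then show "x \<otimes>\<^bsub>monoid_ring M\<^esub> y \<in> carrier (monoid_ring M)"
      using keys_mult[of x y] add_mem by (fastforce simp: monoid_ring_def)
  qed (auto simp: monoid_ring_def zero_mem algebra_simps)
qed (auto simp: monoid_ring_def algebra_simps)

text \<open>The free abelian group supplies an additive \<open>F\<close>. It is multiplicative
  because both sides of that identity are biadditive and agree on pairs of monomials by
  \<open>f_add\<close>.\<close>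

lemma monoid_ring_hom_exists:
  fixes R :: "('a, 'm) ring_scheme" (structure)
  assumes "cring R"
    and f: "\<And>a. a \<in> M \<Longrightarrow> f a \<in> carrier R"
    and f_zero: "f 0 = \<one>"
    and f_add: "\<And>a b. a \<in> M \<Longrightarrow> b \<in> M \<Longrightarrow> f (a + b) = f a \<otimes> f b"
  obtains F where "F \<in> ring_hom (monoid_ring M) R" "\<And>a. a \<in> M \<Longrightarrow> F (frag_of a) = f a"
proof -
  interpret cring R by fact
  obtain F where F: "F \<in> hom (free_Abelian_group M) (add_monoid R)"
    and F_of: "\<And>a. a \<in> M \<Longrightarrow> F (frag_of a) = f a"
    using comm_group.free_Abelian_group_universal[OF a_comm_group, of f M] f by auto
  interpret P: cring "monoid_ring M" by (rule cring_monoid_ring)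
  interpret F: group_hom "free_Abelian_group M" "add_monoid R" F
    using F by (simp add: group_hom_def group_hom_axioms_def)
  have closed: "F p \<in> carrier R" if "Poly_Mapping.keys p \<subseteq> M" for p
    using F.hom_closed[of p] that by simp
  have F_zero: "F 0 = \<zero>"
    using F.hom_one by simp
  \<comment> \<open>The induction rule for free abelian groups builds elements by differences, so
    additivity is needed in this form.\<close>
  have F_diff: "F (p - p') = F p \<ominus> F p'"
    if "Poly_Mapping.keys p \<subseteq> M" "Poly_Mapping.keys p' \<subseteq> M" for p p'
    using F.hom_mult[of p "- p'"] F.hom_inv[of p'] that by (simp add: a_minus_def a_inv_def)
  have keys_mult': "Poly_Mapping.keys (p * p') \<subseteq> M"
    if "Poly_Mapping.keys p \<subseteq> M" "Poly_Mapping.keys p' \<subseteq> M" for p p' :: "'b \<Rightarrow>\<^sub>0 int"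
    using P.m_closed[of p p'] that by (simp add: monoid_ring_def)
  \<comment> \<open>Biadditivity is used one argument at a time: here the left factor is a monomial
    and the right one varies; in \<open>mult\<close> the left one varies too.\<close>
  have mult_of: "F (frag_of a * p) = f a \<otimes> F p" if a: "a \<in> M" and p: "Poly_Mapping.keys p \<subseteq> M" for a p
    using p
  proof (induction p rule: free_Abelian_group_induct[consumes 1, case_names zero diff single])
    case zero
    then show ?case using f[OF a] by (simp add: F_zero)
  next
    case (diff x y)
    then show ?case
      using a f by (simp add: right_diff_distrib F_diff closed keys_mult' minus_eq r_distr r_minus)
  next
    case (single b)
    have "frag_of a * frag_of b = (frag_of (a + b) :: 'b \<Rightarrow>\<^sub>0 int)"
      by (simp add: mult_single)
    then show ?case
      using a single by (simp add: F_of f_add add_mem)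
  qed
  have mult: "F (p * p') = F p \<otimes> F p'"
    if p: "Poly_Mapping.keys p \<subseteq> M" and p': "Poly_Mapping.keys p' \<subseteq> M" for p p'
    using p
  proof (induction p rule: free_Abelian_group_induct[consumes 1, case_names zero diff single])
    case zero
    then show ?case using p' by (simp add: F_zero closed)
  next
    case (diff x y)
    then show ?case
      using p' by (simp add: left_diff_distrib F_diff closed keys_mult' minus_eq l_distr l_minus)
  next
    case (single a)
    then show ?case using p' by (simp add: F_of mult_of)
  qed
  have one: "F 1 = \<one>"
    using F_of[OF zero_mem] f_zero by simp
  have "F \<in> ring_hom (monoid_ring M) R"
  proof (rule ring_hom_memI)
    fix x y assume "x \<in> carrier (monoid_ring M)" "y \<in> carrier (monoid_ring M)"
    then show "F (x \<oplus>\<^bsub>monoid_ring M\<^esub> y) = F x \<oplus> F y"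
      using F.hom_mult[of x y] by (simp add: monoid_ring_def)
  qed (auto simp: monoid_ring_def closed mult one)
  then show thesis
    using F_of that by blast
qed

text \<open>Monomials generate the additive group, so agreement on them spreads through
  differences.\<close>

lemma monoid_ring_hom_eqI:
  fixes R :: "('a, 'm) ring_scheme" (structure)
  assumes "cring R" "F \<in> ring_hom (monoid_ring M) R" "G \<in> ring_hom (monoid_ring M) R"
    and eq: "\<And>a. a \<in> M \<Longrightarrow> F (frag_of a) = G (frag_of a)"
    and p: "p \<in> carrier (monoid_ring M)"
  shows "F p = G p"
proof -
  interpret P: cring "monoid_ring M" by (rule cring_monoid_ring)
  interpret F: ring_hom_cring "monoid_ring M" R F
    using assms by (intro ring_hom_cring.intro ring_hom_cring_axioms.intro P.is_cring)
  interpret G: ring_hom_cring "monoid_ring M" R G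
    using assms by (intro ring_hom_cring.intro ring_hom_cring_axioms.intro P.is_cring)
  \<comment> \<open>Negation in the ring record is derived from its addition; it must be identified
    with negation of polynomials before \<open>hom_minus\<close> applies to
    \<open>x - y\<close>.\<close>
  have neg: "\<ominus>\<^bsub>monoid_ring M\<^esub> y = - y" if "Poly_Mapping.keys y \<subseteq> M" for y
    using that by (intro P.minus_equality) (auto simp: monoid_ring_def)
  have "Poly_Mapping.keys p \<subseteq> M"
    using p by (simp add: monoid_ring_def)
  then show ?thesis
  proof (induction p rule: free_Abelian_group_induct[consumes 1, case_names zero diff single])
    case zero
    then show ?case using F.hom_zero G.hom_zero by (simp add: monoid_ring_def)
  next
    case (diff x y)
    have "x - y = x \<ominus>\<^bsub>monoid_ring M\<^esub> y"
      using diff by (simp add: a_minus_def neg) (simp add: monoid_ring_def)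
    then show ?case
      using diff F.hom_minus[of x y] G.hom_minus[of x y] by (simp add: monoid_ring_def)
  next
    case (single a)
    then show ?case by (rule eq)
  qed
qed

end


section \<open>The Laurent polynomial ring\<close>

interpretation Omega_monoms: add_submonoid "Omega_monoms k"
proof
  fix a b assume "a \<in> Omega_monoms k" "b \<in> Omega_monoms k"
  then show "a + b \<in> Omega_monoms k"
    using keys_add[of a b] by (auto simp: Omega_monoms_def lookup_add)
qed (simp add: Omega_monoms_def)

lemma Omega_eq: "Omega k = monoid_ring (Omega_monoms k)"
  by (simp add: Omega_def monoid_ring_def)

lemma cring_Omega: "cring (Omega k)"
  unfolding Omega_eq by (rule Omega_monoms.cring_monoid_ring)

lemma frag_of_in_Omega: "frag_of m \<in> carrier (Omega k) \<longleftrightarrow> m \<in> Omega_monoms k"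
  by (simp add: Omega_def)

lemma mult_Omega [simp]: "x \<otimes>\<^bsub>Omega k\<^esub> y = x * y"
  and one_Omega [simp]: "\<one>\<^bsub>Omega k\<^esub> = 1"
  by (simp_all add: Omega_def)

lemma single_in_Omega_monoms:
  "v \<in> indets k \<Longrightarrow> 0 \<le> n \<or> v \<in> unit_indets \<Longrightarrow> Poly_Mapping.single v n \<in> Omega_monoms k"
  by (auto simp: Omega_monoms_def lookup_single when_def)

lemma frag_of_single_in_Omega:
  "v \<in> indets k \<Longrightarrow> 0 \<le> n \<or> v \<in> unit_indets \<Longrightarrow>
    frag_of (Poly_Mapping.single v n) \<in> carrier (Omega k)"
  unfolding frag_of_in_Omega by (rule single_in_Omega_monoms)

lemma indet_poly_in_Omega: "v \<in> indets k \<Longrightarrow> indet_poly v \<in> carrier (Omega k)"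
  unfolding indet_poly_def by (rule frag_of_single_in_Omega) auto

text \<open>The inverse is the monomial with negated exponent, which \<open>Omega_monoms k\<close>
  admits because \<open>v\<close> lies in \<open>unit_indets\<close>.\<close>

lemma frag_of_single_Units:
  assumes "v \<in> indets k" "v \<in> unit_indets"
  shows "frag_of (Poly_Mapping.single v n) \<in> Units (Omega k)"
    and "inv\<^bsub>Omega k\<^esub> frag_of (Poly_Mapping.single v n) = frag_of (Poly_Mapping.single v (- n))"
proof -
  interpret cring "Omega k" by (rule cring_Omega)
  have c: "frag_of (Poly_Mapping.single v m) \<in> carrier (Omega k)" for m
    using assms by (intro frag_of_single_in_Omega) auto
  have e: "frag_of (Poly_Mapping.single v m) * frag_of (Poly_Mapping.single v (- m)) = 1" for m :: int
    by (simp add: mult_single flip: single_add)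
  show "frag_of (Poly_Mapping.single v n) \<in> Units (Omega k)"
    unfolding Units_def using c e[of n] e[of "- n"] by auto
  show "inv\<^bsub>Omega k\<^esub> frag_of (Poly_Mapping.single v n) = frag_of (Poly_Mapping.single v (- n))"
    using comm_inv_char[OF c c, of n "- n"] e by simp
qed

lemma indet_poly_Units:
  assumes "v \<in> indets k" "v \<in> unit_indets"
  shows "indet_poly v \<in> Units (Omega k)"
  unfolding indet_poly_def by (rule frag_of_single_Units(1)[OF assms])

lemma finite_indets: "finite (indets k)"
  by (simp add: indets_def)

text \<open>The disjunction mirrors the exponent condition in \<open>Omega_monoms\<close>: a
  negative power involves \<open>inv\<close>, which is controlled only for units.\<close>

lemma (in cring) int_pow_closed':
  assumes "x \<in> carrier R" "0 \<le> (n::int) \<or> x \<in> Units R"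
  shows "x [^] n \<in> carrier R"
proof (cases "0 \<le> n")
  case True
  then show ?thesis
    using nat_pow_closed[OF assms(1), of "nat n"] by simp
next
  case False
  then have "x [^] nat (- n) \<in> Units R"
    using assms by (intro Units_pow_closed) auto
  then show ?thesis
    unfolding int_pow_def2 using False by (simp only: if_True not_le Units_inv_closed)
qed

text \<open>For a unit the law is inherited from the group \<open>units_of R\<close>, whose integer
  powers agree with those of the ring; otherwise both exponents are natural numbers.\<close>

lemma (in cring) int_pow_add:
  assumes x: "x \<in> carrier R" and "(0 \<le> (m::int) \<and> 0 \<le> n) \<or> x \<in> Units R"
  shows "x [^] (m + n) = x [^] m \<otimes> x [^] n"
proof (cases "x \<in> Units R")
  case True
  interpret U: group "units_of R" by (rule units_group)
  have pow: "x [^]\<^bsub>units_of R\<^esub> i = x [^] i" for i :: int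
    unfolding int_pow_def2 units_of_pow[OF True] by (simp only: units_of_inv[OF Units_pow_closed[OF True]])
  show ?thesis
    using U.int_pow_mult[of x m n] True
    by (simp add: pow units_of_carrier units_of_mult)
next
  case False
  then obtain a b where "m = int a" "n = int b"
    using assms(2) nonneg_int_cases by metis
  then show ?thesis
    using nat_pow_mult[OF x, of a b] by (simp only: int_pow_int flip: of_nat_add)
qed

text \<open>Evaluation of Laurent polynomials at \<open>val\<close>: monomials go to the
  corresponding products of powers, and the extension result for monoid rings does the rest.\<close>

lemma Omega_hom_exists:
  fixes R :: "('a, 'm) ring_scheme" (structure)
  assumes "cring R"
    and carr: "\<And>v. v \<in> indets k \<Longrightarrow> val v \<in> carrier R"
    and unit: "\<And>v. v \<in> indets k \<Longrightarrow> v \<in> unit_indets \<Longrightarrow> val v \<in> Units R"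
  obtains F where "F \<in> ring_hom (Omega k) R" "\<And>v. v \<in> indets k \<Longrightarrow> F (indet_poly v) = val v"
proof -
  interpret cring R by fact
  \<comment> \<open>The product runs over all of \<open>indets k\<close> rather than the support of
    \<open>m\<close>, so that \<open>f (a + b)\<close>, \<open>f a\<close> and \<open>f b\<close>
    share one index set; absent indeterminates contribute a zeroth power.\<close>
  define f where "f m = (\<Otimes>v\<in>indets k. val v [^] Poly_Mapping.lookup m v)" for m :: "indet \<Rightarrow>\<^sub>0 int"
  have pow: "val v [^] Poly_Mapping.lookup m v \<in> carrier R"
    if "m \<in> Omega_monoms k" "v \<in> indets k" for m v
    using that carr unit by (intro int_pow_closed') (auto simp: Omega_monoms_def)
  have "f (a + b) = f a \<otimes> f b" if ab: "a \<in> Omega_monoms k" "b \<in> Omega_monoms k" for a b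
  proof -
    have "f (a + b) = (\<Otimes>v\<in>indets k. val v [^] Poly_Mapping.lookup a v \<otimes> val v [^] Poly_Mapping.lookup b v)"
      unfolding f_def
    proof (rule finprod_cong')
      fix v assume v: "v \<in> indets k"
      then show "val v [^] Poly_Mapping.lookup (a + b) v
          = val v [^] Poly_Mapping.lookup a v \<otimes> val v [^] Poly_Mapping.lookup b v"
        unfolding lookup_add
        using v ab by (intro int_pow_add carr) (auto simp: Omega_monoms_def dest: unit)
    qed (use ab pow in auto)
    also have "\<dots> = f a \<otimes> f b"
      unfolding f_def using ab pow by (intro finprod_multf) auto
    finally show ?thesis .
  qed
  moreover have "f m \<in> carrier R" if "m \<in> Omega_monoms k" for m
    unfolding f_def using pow that by (intro finprod_closed) auto
  moreover have "f 0 = \<one>"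
    unfolding f_def by (intro finprod_one_eqI) auto
  ultimately obtain F where F: "F \<in> ring_hom (monoid_ring (Omega_monoms k)) R"
      and F_of: "\<And>m. m \<in> Omega_monoms k \<Longrightarrow> F (frag_of m) = f m"
    using Omega_monoms.monoid_ring_hom_exists[OF \<open>cring R\<close>, of k f] by blast
  have pow_1: "x [^] (1::int) = x" if "x \<in> carrier R" for x
    using int_pow_int[of R x 1] that by simp
  have "F (indet_poly v) = val v" if v: "v \<in> indets k" for v
  proof -
    have "F (indet_poly v) = f (Poly_Mapping.single v 1)"
      using F_of[of "Poly_Mapping.single v 1"] v by (simp add: indet_poly_def single_in_Omega_monoms)
    also have "\<dots> = (\<Otimes>w\<in>indets k. if v = w then val w else \<one>)"
      unfolding f_def using carr
      by (intro finprod_cong') (auto simp: lookup_single when_def pow_1)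
    also have "\<dots> = val v"
      using v carr finite_indets by (intro finprod_singleton) auto
    finally show ?thesis .
  qed
  then show thesis
    using F that by (simp add: Omega_eq)
qed

text \<open>Homomorphisms preserve inverses of units, so the values on the indeterminates fix those
  on negative powers too, hence on monomials, hence everywhere.\<close>

lemma Omega_hom_eqI:
  fixes R :: "('a, 'm) ring_scheme" (structure)
  assumes "cring R" and F: "F \<in> ring_hom (Omega k) R" and G: "G \<in> ring_hom (Omega k) R"
    and eq: "\<And>v. v \<in> indets k \<Longrightarrow> F (indet_poly v) = G (indet_poly v)"
    and p: "p \<in> carrier (Omega k)"
  shows "F p = G p"
proof -
  interpret F: ring_hom_cring "Omega k" R F
    by (intro ring_hom_cring.intro ring_hom_cring_axioms.intro cring_Omega \<open>cring R\<close> F)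
  interpret G: ring_hom_cring "Omega k" R G
    by (intro ring_hom_cring.intro ring_hom_cring_axioms.intro cring_Omega \<open>cring R\<close> G)
  have nonneg: "F (frag_of (Poly_Mapping.single v (int n))) = G (frag_of (Poly_Mapping.single v (int n)))"
    if v: "v \<in> indets k" for v n
  proof (induction n)
    case 0
    then show ?case using F.hom_one G.hom_one by simp
  next
    case (Suc n)
    have c: "frag_of (Poly_Mapping.single v (int n)) \<in> carrier (Omega k)"
      using v by (intro frag_of_single_in_Omega) auto
    have "frag_of (Poly_Mapping.single v (int (Suc n)))
        = indet_poly v \<otimes>\<^bsub>Omega k\<^esub> frag_of (Poly_Mapping.single v (int n))"
      by (simp add: indet_poly_def mult_single flip: single_add)
    then show ?case
      using c indet_poly_in_Omega[OF v] eq[OF v] Suc by (simp only: F.hom_mult G.hom_mult)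
  qed
  have single: "F (frag_of (Poly_Mapping.single v n)) = G (frag_of (Poly_Mapping.single v n))"
    if v: "v \<in> indets k" and n: "0 \<le> n \<or> v \<in> unit_indets" for v n
  proof (cases "0 \<le> n")
    case True
    then show ?thesis using nonneg[OF v, of "nat n"] by simp
  next
    case False
    with n have u: "v \<in> unit_indets" by simp
    have "F (frag_of (Poly_Mapping.single v (- n))) = G (frag_of (Poly_Mapping.single v (- n)))"
      using nonneg[OF v, of "nat (- n)"] False by simp
    \<comment> \<open>The monomial of exponent \<open>n\<close> is the inverse of the one of
      exponent \<open>- n\<close>, which is already covered by \<open>nonneg\<close>.\<close>
    then show ?thesis
      using frag_of_single_Units[OF v u, of "- n"]
        F.hom_Units(2)[OF frag_of_single_Units(1)[OF v u, of "- n"]]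
        G.hom_Units(2)[OF frag_of_single_Units(1)[OF v u, of "- n"]]
      by simp
  qed
  \<comment> \<open>The induction is on a finite set \<open>V\<close> containing the support; in the
    end \<open>V\<close> is the support itself.\<close>
  have monom: "F (frag_of m) = G (frag_of m)"
    if "finite V" "m \<in> Omega_monoms k" "Poly_Mapping.keys m \<subseteq> V" for m V
    using that
  proof (induction V arbitrary: m)
    case empty
    then show ?case using F.hom_one G.hom_one by simp
  next
    case (insert v V)
    show ?case
    proof (cases "v \<in> Poly_Mapping.keys m")
      case False
      then show ?thesis using insert by auto
    next
      case True
      define n where "n = Poly_Mapping.lookup m v"
      \<comment> \<open>Splitting off the whole power of \<open>v\<close>, whatever its sign,
        removes \<open>v\<close> from the support and leaves the other exponents unchanged.\<close>
      define m' where "m' = m - Poly_Mapping.single v n"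
      have lookup_m': "Poly_Mapping.lookup m' w = (if w = v then 0 else Poly_Mapping.lookup m w)" for w
        by (simp add: m'_def n_def lookup_minus lookup_single when_def)
      then have keys_m': "Poly_Mapping.keys m' = Poly_Mapping.keys m - {v}"
        by (auto simp: in_keys_iff split: if_splits)
      have m': "m' \<in> Omega_monoms k"
        using insert.prems(1) keys_m' lookup_m' by (auto simp: Omega_monoms_def)
      have v: "v \<in> indets k" and n: "0 \<le> n \<or> v \<in> unit_indets"
        using insert.prems(1) True by (auto simp: Omega_monoms_def n_def)
      have IH: "F (frag_of m') = G (frag_of m')"
        using insert.IH[OF m'] insert.prems(2) keys_m' by auto
      have "m = Poly_Mapping.single v n + m'"
        by (simp add: m'_def)
      then have e: "frag_of m = frag_of (Poly_Mapping.single v n) \<otimes>\<^bsub>Omega k\<^esub> frag_of m'"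
        by (simp add: mult_single)
      have "frag_of (Poly_Mapping.single v n) \<in> carrier (Omega k)" "frag_of m' \<in> carrier (Omega k)"
        using m' frag_of_single_in_Omega[OF v n] by (simp_all only: frag_of_in_Omega)
      then show ?thesis
        unfolding e by (simp only: F.hom_mult G.hom_mult IH single[OF v n])
    qed
  qed
  show ?thesis
    using Omega_monoms.monoid_ring_hom_eqI[of R F k G p] monom[OF finite_keys _ order_refl]
      assms by (simp only: Omega_eq)
qed


section \<open>Admissibility relations under ring homomorphisms\<close>

text \<open>Collects what is needed to transport the relators along \<open>\<phi>\<close>. The
  families are constrained only below \<open>k\<close>, because indeterminates of index
  \<open>k\<close> or larger lie outside \<open>Omega k\<close>.\<close>

locale parameter_hom = ring_hom_cring R S \<phi>
  for R :: "('a, 'm) ring_scheme" (structure) and S :: "('b, 'n) ring_scheme" (structure) and \<phi> +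
  fixes k :: nat and A qs :: "nat \<Rightarrow> 'a" and q lam :: 'a
    and A' qs' :: "nat \<Rightarrow> 'b" and q' lam' :: 'b
  assumes k_pos: "1 \<le> k"
    and A_closed: "i < k \<Longrightarrow> A i \<in> carrier R" and qs_closed: "i < k \<Longrightarrow> qs i \<in> carrier R"
    and q_unit: "q \<in> Units R" and lam_unit: "lam \<in> Units R" and qs0_unit: "qs 0 \<in> Units R"
    and hom_A: "i < k \<Longrightarrow> \<phi> (A i) = A' i" and hom_qs: "i < k \<Longrightarrow> \<phi> (qs i) = qs' i"
    and hom_q: "\<phi> q = q'" and hom_lam: "\<phi> lam = lam'"
begin

lemma qx_closed: "i \<le> k \<Longrightarrow> qx R k qs i \<in> carrier R"
  by (auto simp: qx_def qs_closed)

lemma hom_qx: "i \<le> k \<Longrightarrow> \<phi> (qx R k qs i) = qx S k qs' i"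
  by (auto simp: qx_def hom_qs)

text \<open>As \<open>k\<close> is positive, index \<open>0\<close> avoids the convention for
  \<open>qx k\<close>; so \<open>inv (qx 0)\<close> in \<open>h\<close> and \<open>h'\<close>
  inverts a unit.\<close>

lemma qx0_unit: "qx R k qs 0 \<in> Units R"
  using k_pos qs0_unit by (auto simp: qx_def)

lemma hom_inv:
  "\<phi> (inv q) = inv\<^bsub>S\<^esub> q'" "\<phi> (inv lam) = inv\<^bsub>S\<^esub> lam'" "\<phi> (inv (qs 0)) = inv\<^bsub>S\<^esub> (qs' 0)"
  "\<phi> (inv (qx R k qs 0)) = inv\<^bsub>S\<^esub> (qx S k qs' 0)"
  using k_pos q_unit lam_unit qs0_unit qx0_unit
  by (simp_all add: hom_Units hom_q hom_lam hom_qs hom_qx)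

lemma delta_closed: "delta R q \<in> carrier R"
  using q_unit by (simp add: delta_def R.Units_closed)

lemma hom_delta: "\<phi> (delta R q) = delta S q'"
  using q_unit by (simp add: delta_def hom_minus hom_inv hom_q R.Units_closed)

lemmas closed = A_closed qx_closed delta_closed q_unit lam_unit qs0_unit qx0_unit qs_closed
  q_unit[THEN R.Units_closed] lam_unit[THEN R.Units_closed] qs0_unit[THEN R.Units_closed]

lemmas homs = hom_A hom_qs hom_q hom_lam hom_qx hom_inv hom_delta hom_minus hom_add_pow

lemma hom_beta:
  "beta R k qs q lam \<in> carrier R" "\<phi> (beta R k qs q lam) = beta S k qs' q' lam'"
  using k_pos by (simp_all add: beta_def closed homs)

lemma hom_h0:
  "h0 R A q lam \<in> carrier R" "\<phi> (h0 R A q lam) = h0 S A' q' lam'"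
  using k_pos by (simp_all add: h0_def closed homs)

lemma hom_h:
  assumes l: "l \<in> {1..zz k - eps k}"
  shows "Defs.h R k A qs q lam l \<in> carrier R"
    and "\<phi> (Defs.h R k A qs q lam l) = Defs.h S k A' qs' q' lam' l"
proof -
  \<comment> \<open>Here \<open>zz k - eps k\<close> is \<open>k div 2\<close>. The bound
    \<open>1 \<le> l\<close> keeps \<open>k - l\<close>, the largest index of \<open>A\<close>,
    below \<open>k\<close>.\<close>
  have lk: "1 \<le> l" "l < k"
    using l by (auto simp: zz_def eps_def)
  let ?a = "\<Oplus>r\<in>{1..k - l}. qx R k qs (r + l) \<otimes> A r"
  let ?b = "\<Oplus>i\<in>{max (l + 1) (zz k)..(l + k) div 2}. qx R k qs (2 * i - l)"
  let ?c = "\<Oplus>i\<in>{(l + 1) div 2..min l (zz k - 1)}. qx R k qs (2 * i - l)"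
  have a: "?a \<in> carrier R" "\<phi> ?a = (\<Oplus>\<^bsub>S\<^esub>r\<in>{1..k - l}. qx S k qs' (r + l) \<otimes>\<^bsub>S\<^esub> A' r)"
    using lk by (intro R.finsum_closed hom_finsum_cong; auto simp: closed homs)+
  have b: "?b \<in> carrier R"
    "\<phi> ?b = (\<Oplus>\<^bsub>S\<^esub>i\<in>{max (l + 1) (zz k)..(l + k) div 2}. qx S k qs' (2 * i - l))"
    using lk by (intro R.finsum_closed hom_finsum_cong; auto intro!: qx_closed hom_qx)+
  have c: "?c \<in> carrier R"
    "\<phi> ?c = (\<Oplus>\<^bsub>S\<^esub>i\<in>{(l + 1) div 2..min l (zz k - 1)}. qx S k qs' (2 * i - l))"
    using lk by (intro R.finsum_closed hom_finsum_cong; auto intro!: qx_closed hom_qx)+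
  show "Defs.h R k A qs q lam l \<in> carrier R"
    "\<phi> (Defs.h R k A qs q lam l) = Defs.h S k A' qs' q' lam' l"
    unfolding Defs.h_def using a b c lk by (simp_all add: closed homs)
qed

lemma hom_h':
  assumes l: "l \<in> {1..zz k - eps k}"
  shows "h' R k A qs l \<in> carrier R" and "\<phi> (h' R k A qs l) = h' S k A' qs' l"
proof -
  have lk: "1 \<le> l" "l < k"
    using l by (auto simp: zz_def eps_def)
  let ?w = "inv (qx R k qs 0)" and ?w' = "inv\<^bsub>S\<^esub> (qx S k qs' 0)"
  let ?t = "\<lambda>i. ?w \<otimes> qx R k qs (k + l - 2 * i) \<oplus> qx R k qs (2 * i - l)"
  let ?t' = "\<lambda>i. ?w' \<otimes>\<^bsub>S\<^esub> qx S k qs' (k + l - 2 * i) \<oplus>\<^bsub>S\<^esub> qx S k qs' (2 * i - l)"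
  let ?a = "\<Oplus>r\<in>{1..l}. ?w \<otimes> qx R k qs (r + k - l) \<otimes> A r"
  let ?b = "\<Oplus>r\<in>{0..k - l}. qx R k qs (r + l) \<otimes> A r"
  let ?c = "\<Oplus>i\<in>{(l + 1) div 2..l - 1}. ?t i"
  let ?d = "\<Oplus>i\<in>{zz k..(l + k) div 2}. ?t i"
  have w: "?w \<in> carrier R"
    using qx0_unit by simp
  have a: "?a \<in> carrier R" "\<phi> ?a = (\<Oplus>\<^bsub>S\<^esub>r\<in>{1..l}. ?w' \<otimes>\<^bsub>S\<^esub> qx S k qs' (r + k - l) \<otimes>\<^bsub>S\<^esub> A' r)"
    using lk w by (intro R.finsum_closed hom_finsum_cong; auto simp: closed homs)+
  have b: "?b \<in> carrier R" "\<phi> ?b = (\<Oplus>\<^bsub>S\<^esub>r\<in>{0..k - l}. qx S k qs' (r + l) \<otimes>\<^bsub>S\<^esub> A' r)"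
    using lk by (intro R.finsum_closed hom_finsum_cong; auto simp: closed homs)+
  \<comment> \<open>The lower bound on \<open>2 * i\<close> keeps \<open>k + l - 2 * i\<close> at
    most \<open>k\<close>, the upper bound does so for \<open>2 * i - l\<close>. Both ranges of
    \<open>i\<close> in \<open>h'\<close> satisfy them.\<close>
  have t: "?t i \<in> carrier R \<and> \<phi> (?t i) = ?t' i" if "l \<le> 2 * i" "2 * i \<le> l + k" for i
  proof -
    have "k + l - 2 * i \<le> k" "2 * i - l \<le> k"
      using that lk by auto
    then show ?thesis
      using w by (simp add: closed homs)
  qed
  have c: "?c \<in> carrier R" "\<phi> ?c = (\<Oplus>\<^bsub>S\<^esub>i\<in>{(l + 1) div 2..l - 1}. ?t' i)"
  proof -
    have "?t i \<in> carrier R \<and> \<phi> (?t i) = ?t' i" if "i \<in> {(l + 1) div 2..l - 1}" for i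
      using that lk by (intro t) auto
    then show "?c \<in> carrier R" "\<phi> ?c = (\<Oplus>\<^bsub>S\<^esub>i\<in>{(l + 1) div 2..l - 1}. ?t' i)"
      by (intro R.finsum_closed hom_finsum_cong; blast)+
  qed
  have d: "?d \<in> carrier R" "\<phi> ?d = (\<Oplus>\<^bsub>S\<^esub>i\<in>{zz k..(l + k) div 2}. ?t' i)"
  proof -
    have "?t i \<in> carrier R \<and> \<phi> (?t i) = ?t' i" if "i \<in> {zz k..(l + k) div 2}" for i
      using that lk by (intro t) (auto simp: zz_def)
    then show "?d \<in> carrier R" "\<phi> ?d = (\<Oplus>\<^bsub>S\<^esub>i\<in>{zz k..(l + k) div 2}. ?t' i)"
      by (intro R.finsum_closed hom_finsum_cong; blast)+
  qed
  show "h' R k A qs l \<in> carrier R" "\<phi> (h' R k A qs l) = h' S k A' qs' l"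
    unfolding h'_def using a b c d by (simp_all add: hom_minus)
qed

lemma relators_closed: "relators R k A qs q lam \<subseteq> carrier R"
  unfolding relators_def using hom_beta hom_h0 hom_h hom_h' by auto

text \<open>Carries the generators of \<open>I0 k\<close> to the relators of the target, where
  admissibility makes them vanish.\<close>

lemma hom_relators: "\<phi> ` relators R k A qs q lam = relators S k A' qs' q' lam'"
  unfolding relators_def image_Un image_image image_insert image_empty
  by (simp add: hom_beta hom_h0 hom_h hom_h' cong: image_cong_simp)

end


text \<open>Functions are total and \<open>ring_hom\<close> says nothing off the carrier;
  \<open>extensional\<close> fixes those values, so that uniqueness concerns the homomorphism
  itself.\<close>

theorem proposition3p4:
  fixes R :: "('a, 'm) ring_scheme" (structure)
    and k :: nat
    and A qs :: "nat \<Rightarrow> 'a"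
    and q lam :: 'a
  assumes "cring R"
    and "k \<ge> 1"
    and "A 0 \<in> Units R" "qs 0 \<in> Units R" "q \<in> Units R" "lam \<in> Units R"
    and "\<And>i. 1 \<le> i \<Longrightarrow> i < k \<Longrightarrow> qs i \<in> carrier R"
    and "\<And>i. 1 \<le> i \<Longrightarrow> i < k \<Longrightarrow> A i \<in> carrier R"
    and "lam \<ominus> inv lam = delta R q \<otimes> (\<one> \<ominus> A 0)"
    and "admissible R k A qs q lam"
  shows "\<exists>!f. f \<in> ring_hom (R0 k) R \<and> f \<in> extensional (carrier (R0 k))
    \<and> f (R0_param k Ind_q) = q
    \<and> f (R0_param k Ind_lam) = lam
    \<and> (\<forall>i<k. f (R0_param k (Ind_qs i)) = qs i)
    \<and> (\<forall>i<k. f (R0_param k (Ind_A i)) = A i)"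
proof -
  interpret R: cring R by fact
  interpret \<Omega>: cring "Omega k" by (rule cring_Omega)
  have A_closed: "A i \<in> carrier R" and qs_closed: "qs i \<in> carrier R" if "i < k" for i
    using assms(3,4,7,8) that by (cases "i = 0"; simp add: R.Units_closed)+
  define val where "val v = (case v of Ind_q \<Rightarrow> q | Ind_lam \<Rightarrow> lam | Ind_qs i \<Rightarrow> qs i | Ind_A i \<Rightarrow> A i)" for v
  obtain F where F: "F \<in> ring_hom (Omega k) R"
    and F_indet: "\<And>v. v \<in> indets k \<Longrightarrow> F (indet_poly v) = val v"
  proof (rule Omega_hom_exists[OF \<open>cring R\<close>, of k val])
    show "val v \<in> carrier R" if "v \<in> indets k" for v
      using that A_closed qs_closed assms(5,6) by (auto simp: indets_def val_def)
    show "val v \<in> Units R" if "v \<in> unit_indets" for v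
      using that assms(3-6) by (auto simp: unit_indets_def val_def)
  qed (use that in blast)
  interpret F: ring_hom_cring "Omega k" R F
    using F by unfold_locales
  interpret F: parameter_hom "Omega k" R F k "\<lambda>i. indet_poly (Ind_A i)" "\<lambda>i. indet_poly (Ind_qs i)"
      "indet_poly Ind_q" "indet_poly Ind_lam" A qs q lam
    using \<open>k \<ge> 1\<close> by unfold_locales
      (auto simp: F_indet val_def indets_def unit_indets_def intro!: indet_poly_in_Omega indet_poly_Units)
  have I0: "ideal (I0 k) (Omega k)"
    unfolding I0_def by (rule \<Omega>.genideal_ideal[OF F.relators_closed])
  \<comment> \<open>The kernel is an ideal that contains all relators by admissibility, and
    \<open>I0 k\<close> is the least such ideal.\<close>
  have "I0 k \<subseteq> a_kernel (Omega k) R F"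
    unfolding I0_def
  proof (rule \<Omega>.genideal_minimal)
    show "ideal (a_kernel (Omega k) R F) (Omega k)"
      by (rule ring_hom_ring.kernel_is_ideal)
        (simp add: ring_hom_ring_def ring_hom_ring_axioms_def \<Omega>.ring_axioms R.ring_axioms)
    show "relators (Omega k) k (\<lambda>i. indet_poly (Ind_A i)) (\<lambda>i. indet_poly (Ind_qs i))
        (indet_poly Ind_q) (indet_poly Ind_lam) \<subseteq> a_kernel (Omega k) R F"
      using F.relators_closed F.hom_relators assms(10)
      unfolding admissible_def a_kernel_def' by blast
  qed
  then have ker: "F x = \<zero>" if "x \<in> I0 k" for x
    using that unfolding a_kernel_def' by blast
  obtain f where f: "f \<in> ring_hom (R0 k) R" "f \<in> extensional (carrier (R0 k))"
    and f_coset: "\<And>x. x \<in> carrier (Omega k) \<Longrightarrow> f (I0 k +>\<^bsub>Omega k\<^esub> x) = F x"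
    using F.quotient_hom_exists[OF I0 ker] unfolding R0_def by blast
  have f_param: "f (R0_param k v) = val v" if "v \<in> indets k" for v
    using that by (simp add: R0_param_def f_coset indet_poly_in_Omega F_indet)
  interpret I0: ideal "I0 k" "Omega k" by (rule I0)
  have unique: "g = f" if g: "g \<in> ring_hom (R0 k) R" "g \<in> extensional (carrier (R0 k))"
    and g_param: "\<And>v. v \<in> indets k \<Longrightarrow> g (R0_param k v) = val v" for g
  proof (rule extensionalityI[OF g(2) f(2)])
    fix X assume "X \<in> carrier (R0 k)"
    then obtain x where x: "X = I0 k +>\<^bsub>Omega k\<^esub> x" "x \<in> carrier (Omega k)"
      unfolding R0_def FactRing_def A_RCOSETS_def' by auto
    \<comment> \<open>Composing with the projection moves the comparison to \<open>Omega k\<close>,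
      where agreement on the indeterminates suffices.\<close>
    have "g \<circ> (\<lambda>x. I0 k +>\<^bsub>Omega k\<^esub> x) \<in> ring_hom (Omega k) R"
      using ring_hom_trans[OF I0.rcos_ring_hom] g(1) by (simp add: R0_def)
    moreover have "(g \<circ> (\<lambda>x. I0 k +>\<^bsub>Omega k\<^esub> x)) (indet_poly v) = F (indet_poly v)"
      if "v \<in> indets k" for v
      using g_param[OF that] F_indet[OF that] by (simp add: R0_param_def)
    ultimately have "(g \<circ> (\<lambda>x. I0 k +>\<^bsub>Omega k\<^esub> x)) x = F x"
      using Omega_hom_eqI[OF \<open>cring R\<close> _ F _ x(2)] by blast
    then show "g X = f X"
      using x f_coset by simp
  qed
  \<comment> \<open>Bundles the four conditions on parameters into one over \<open>indets k\<close>,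
    the form in which existence and uniqueness were obtained.\<close>
  have params: "(\<forall>v\<in>indets k. g (R0_param k v) = val v) \<longleftrightarrow>
      g (R0_param k Ind_q) = q \<and> g (R0_param k Ind_lam) = lam
      \<and> (\<forall>i<k. g (R0_param k (Ind_qs i)) = qs i) \<and> (\<forall>i<k. g (R0_param k (Ind_A i)) = A i)" for g
    by (auto simp: indets_def val_def)
  show ?thesis
    unfolding params[symmetric] using f f_param unique by blast
qed

end
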